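(* The intersection of $M\setminus L$ with $(3.942,3.943)$ is non-empty. The largest known element of $M\setminus L$ is $$m_1=\lambda_0(\overline{w}\,w^*\,w\,1211111\,\overline{23})=3.94200115991134146921437465\ldots\approx j_0+8.26\cdot 10^{-22}.$$
   Context: For $\underline a=(a_i)_{i\in\mathbb Z}\in\{1,2,3,\ldots\}^{\mathbb Z}$ and $j\in\mathbb Z$ let $\lambda_j(\underline a)=[a_j;a_{j+1},a_{j+2},\ldots]+[0;a_{j-1},a_{j-2},\ldots]$ (continued fractions), $\ell(\underline a)=\limsup_{j\to\infty}\lambda_j(\underline a)$ and $m(\underline a)=\sup_{j\in\mathbb Z}\lambda_j(\underline a)$. The Lagrange spectrum $L\subset\mathbb R$ is the set of finite values $\ell(\underline a)$, and the Markov spectrum $M\subset\mathbb R$ is the set of finite values $m(\underline a)$; it is known that $L\subset M$. Sequences are written as concatenations of one-digit terms. An overline denotes infinite periodic repetition (to the left at the left end, to the right at the right end, and in both directions if the whole sequence is overlined), and the asterisk marks the entry of index $0$. Let $w=12111233311133232$ and $w^*=121112333^*11133232$ (the same word with the index-$0$ position marked), and let $j_0=m(\overline{121112333^*11133232})=\lambda_0(\overline{121112333^*11133232})=3.942001159911341469213548\ldots\in L$. "Largest known" refers to what was known at the time of the paper presenting this result. *)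

theory Defs
  imports "HOL-Analysis.Analysis"
begin

primrec convergent_value :: "nat \<Rightarrow> (nat \<Rightarrow> nat) \<Rightarrow> real" where
  "convergent_value 0 c = real (c 0)"
| "convergent_value (Suc n) c = real (c 0) + 1 / convergent_value n (\<lambda>k. c (Suc k))"

(* The infinite continued fraction [c 0; c 1, c 2, ...], as the limit of its convergents;
   meaningful when c k >= 1 for all k >= 1. *)
definition contfrac :: "(nat \<Rightarrow> nat) \<Rightarrow> real" where
  "contfrac c = lim (\<lambda>n. convergent_value n c)"

definition lambda_at :: "(int \<Rightarrow> nat) \<Rightarrow> int \<Rightarrow> real" where
  "lambda_at a j = contfrac (\<lambda>k. a (j + int k))
     + contfrac (\<lambda>k. if k = 0 then 0 else a (j - int k))"

(* Both values are taken in the extended reals, so that an infinite value is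
   recognised as such when the spectra are formed. *)
definition lagrange_value :: "(int \<Rightarrow> nat) \<Rightarrow> ereal" where
  "lagrange_value a = Limsup at_top (\<lambda>j. ereal (lambda_at a j))"

definition markov_value :: "(int \<Rightarrow> nat) \<Rightarrow> ereal" where
  "markov_value a = (SUP j. ereal (lambda_at a j))"

definition lagrange_spectrum :: "real set" where
  "lagrange_spectrum = {x. \<exists>a. (\<forall>i. 1 \<le> a i) \<and> lagrange_value a = ereal x}"

definition markov_spectrum :: "real set" where
  "markov_spectrum = {x. \<exists>a. (\<forall>i. 1 \<le> a i) \<and> markov_value a = ereal x}"

(* The sequence ...uuu c vvv..., with index 0 at the entry c ! k of the central word
   (counting from 0); p is the position relative to the start of c.  As mod on the
   integers is nonnegative, the position p = -1 carries the last letter of u. *)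
definition biinfinite :: "nat list \<Rightarrow> nat list \<Rightarrow> nat \<Rightarrow> nat list \<Rightarrow> int \<Rightarrow> nat" where
  "biinfinite u c k v i =
     (let p = i + int k in
      if p < 0 then u ! nat (p mod int (length u))
      else if p < int (length c) then c ! nat p
      else v ! nat ((p - int (length c)) mod int (length v)))"

definition w :: "nat list" where
  "w = [1,2,1,1,1,2,3,3,3,1,1,1,3,3,2,3,2]"

(* The asterisk in 121112333^*11133232 sits on the letter w ! 8. *)
definition j0_seq :: "int \<Rightarrow> nat" where
  "j0_seq = biinfinite w w 8 w"

definition m1_seq :: "int \<Rightarrow> nat" where
  "m1_seq = biinfinite w (w @ w @ [1,2,1,1,1,1,1]) 8 [2,3]"

definition j0 :: real where
  "j0 = real_of_ereal (markov_value j0_seq)"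

definition m1 :: real where
  "m1 = lambda_at m1_seq 0"

end

theory Submission
  imports Defs "HOL-Library.Sublist"
begin

text \<open>Fix a lower and an upper threshold within 1.4 / 10^24 of m1. Suppose that m1 is the
  Lagrange value of a sequence a, so that from some position on the values lambda_j(a) stay below
  the upper threshold, while they exceed the lower one infinitely often. A finite search over words
  in the digits 1, 2, 3, pruned by bounds for lambda_0 and by a short list of forbidden words, shows
  that around each position j of the latter kind a reads like the sequence of m1 or like its
  reversal, for at least 29 digits on the w-periodic side and 31 digits on the other. A second
  search shows that, below the upper threshold, a sufficiently long piece of the periodic sequence
  of w forces another period w to its left. Hence a is w-periodic all the way from such a position
  back to where the values start to stay below the threshold or, in the reversed case, all the way
  to the right. But this stretch contains further positions of the same kind, and next to each of
  them 12111 is followed by 1 where w continues with 2.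

  That m1 is the Markov value of its own sequence is checked on finite windows: except at the
  copies of the marked digit all values are at most 3.94, and at the copies other than position 0
  they are close to j0 or smaller.\<close>

section \<open>Continued fractions\<close>

lemma convergent_value_bounds:
  assumes "\<And>k. 1 \<le> c k"
  shows "real (c 0) \<le> convergent_value n c \<and> convergent_value n c \<le> real (c 0) + 1"
  using assms
proof (induction n arbitrary: c)
  case (Suc n)
  have "1 \<le> real (c (Suc 0))"
    using Suc.prems[of "Suc 0"] by linarith
  moreover have "real (c (Suc 0)) \<le> convergent_value n (\<lambda>k. c (Suc k))"
    using Suc.IH[where c = "\<lambda>k. c (Suc k)"] Suc.prems by auto
  ultimately have "1 \<le> convergent_value n (\<lambda>k. c (Suc k))"
    by linarith
  then show ?case
    by simp
qed auto

lemma convergent_value_ge_1: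
  assumes "\<And>k. 1 \<le> c k"
  shows "1 \<le> convergent_value n c"
proof -
  have "1 \<le> real (c 0)" using assms[of 0] by linarith
  then show ?thesis using convergent_value_bounds[where c = c and n = n, OF assms] by linarith
qed

text \<open>Two steps of the recursion send x to c 0 + x / (c 1 * x + 1), a contraction with factor 1/4 on
  the half-line x \<ge> 1.\<close>
lemma convergent_value_dist:
  assumes "\<And>k. 1 \<le> c k"
  shows "\<bar>convergent_value (m + 2 * N) c - convergent_value (n + 2 * N) c\<bar> \<le> (1 / 4) ^ N"
  using assms
proof (induction N arbitrary: c)
  case 0
  then show ?case
    using convergent_value_bounds[where c = c and n = m]
      convergent_value_bounds[where c = c and n = n] by force
next
  case (Suc N)
  define d where "d = real (c (Suc 0))"
  define x where "x = convergent_value (m + 2 * N) (\<lambda>k. c (Suc (Suc k)))"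
  define y where "y = convergent_value (n + 2 * N) (\<lambda>k. c (Suc (Suc k)))"
  have x: "1 \<le> x" and y: "1 \<le> y"
    unfolding x_def y_def by (rule convergent_value_ge_1, rule Suc.prems)+
  have d: "1 \<le> d"
    unfolding d_def using Suc.prems[of "Suc 0"] by linarith
  have dx: "2 \<le> d * x + 1" "2 \<le> d * y + 1"
    using mult_mono[OF d x] mult_mono[OF d y] d by auto
  have "convergent_value (m + 2 * Suc N) c - convergent_value (n + 2 * Suc N) c
      = 1 / (d + 1 / x) - 1 / (d + 1 / y)"
    by (simp add: d_def x_def y_def)
  also have "\<dots> = x / (d * x + 1) - y / (d * y + 1)"
    using x y by (simp add: divide_simps)
  also have "\<dots> = (x - y) / ((d * x + 1) * (d * y + 1))"
    using dx by (simp add: field_simps)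
  finally have "\<bar>convergent_value (m + 2 * Suc N) c - convergent_value (n + 2 * Suc N) c\<bar>
      = \<bar>x - y\<bar> / ((d * x + 1) * (d * y + 1))"
    using dx by (simp add: abs_mult)
  also have "\<dots> \<le> \<bar>x - y\<bar> / 4"
    using mult_mono[OF dx] dx by (intro divide_left_mono) auto
  also have "\<dots> \<le> (1 / 4) ^ Suc N"
    using Suc.IH[where c = "\<lambda>k. c (Suc (Suc k))"] Suc.prems by (simp add: x_def y_def)
  finally show ?case .
qed

lemma convergent_value_tendsto_contfrac:
  assumes "\<And>k. 1 \<le> c k"
  shows "(\<lambda>n. convergent_value n c) \<longlonglongrightarrow> contfrac c"
proof -
  have "Cauchy (\<lambda>n. convergent_value n c)"
  proof (rule metric_CauchyI)
    fix e :: real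
    assume "0 < e"
    then obtain N where N: "(1 / 4 :: real) ^ N < e"
      using real_arch_pow_inv[of e "1 / 4"] by auto
    have "dist (convergent_value m c) (convergent_value n c) < e" if "2 * N \<le> m" "2 * N \<le> n" for m n
      using convergent_value_dist[where c = c and m = "m - 2 * N" and n = "n - 2 * N" and N = N] assms that N
      by (simp add: dist_real_def)
    then show "\<exists>M. \<forall>m\<ge>M. \<forall>n\<ge>M. dist (convergent_value m c) (convergent_value n c) < e"
      by blast
  qed
  then show ?thesis
    unfolding contfrac_def by (simp add: Cauchy_convergent_iff convergent_LIMSEQ_iff)
qed

lemma contfrac_ge_1:
  assumes "\<And>k. 1 \<le> c k"
  shows "1 \<le> contfrac c"
proof (rule LIMSEQ_le_const)
  show "(\<lambda>n. convergent_value n c) \<longlonglongrightarrow> contfrac c"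
    by (rule convergent_value_tendsto_contfrac) (rule assms)
  show "\<exists>N. \<forall>n\<ge>N. 1 \<le> convergent_value n c"
    using convergent_value_ge_1[of c] assms by blast
qed

lemma contfrac_rec:
  assumes "\<And>k. 1 \<le> c (Suc k)"
  shows "contfrac c = real (c 0) + 1 / contfrac (\<lambda>k. c (Suc k))"
proof -
  have "(\<lambda>n. convergent_value (Suc n) c) \<longlonglongrightarrow> real (c 0) + 1 / contfrac (\<lambda>k. c (Suc k))"
    using convergent_value_tendsto_contfrac[of "\<lambda>k. c (Suc k)"]
      contfrac_ge_1[of "\<lambda>k. c (Suc k)"] assms
    by (auto intro!: tendsto_intros)
  then have "(\<lambda>n. convergent_value n c) \<longlonglongrightarrow> real (c 0) + 1 / contfrac (\<lambda>k. c (Suc k))"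
    by (rule LIMSEQ_imp_Suc)
  then show ?thesis
    unfolding contfrac_def by (rule limI)
qed

section \<open>Fractional parts on the two sides of a position\<close>

definition cf0 :: "(nat \<Rightarrow> nat) \<Rightarrow> real" where
  "cf0 c = 1 / contfrac c"

lemma cf0_pos: "(\<And>k. 1 \<le> c k) \<Longrightarrow> 0 < cf0 c"
  using contfrac_ge_1[of c] by (simp add: cf0_def)

lemma cf0_le_1: "(\<And>k. 1 \<le> c k) \<Longrightarrow> cf0 c \<le> 1"
  using contfrac_ge_1[of c] by (simp add: cf0_def)

lemma cf0_rec: "(\<And>k. 1 \<le> c k) \<Longrightarrow> cf0 c = 1 / (real (c 0) + cf0 (\<lambda>k. c (Suc k)))"
  unfolding cf0_def by (subst contfrac_rec) auto

text \<open>A first digit at most 3 and a tail at most 1 give 1/4. The same for the tail makes the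
  denominator at least 5/4. These bounds are the base case of \<open>cf_bounds\<close>.\<close>

lemma cf0_bounds:
  assumes c: "\<And>k. 1 \<le> c k" and "c 0 \<le> 3" "c 1 \<le> 3"
  shows "1 / 4 \<le> cf0 c" "cf0 c \<le> 4 / 5"
proof -
  define c' where "c' = (\<lambda>k. c (Suc k))"
  have c': "\<And>k. 1 \<le> c' k" "\<And>k. 1 \<le> c' (Suc k)" and "c' 0 \<le> 3"
    using assms by (auto simp: c'_def)
  have *: "1 / 4 \<le> cf0 d" if "\<And>k. 1 \<le> d k" "d 0 \<le> 3" for d
  proof -
    have "0 < cf0 (\<lambda>k. d (Suc k))" "cf0 (\<lambda>k. d (Suc k)) \<le> 1"
      using cf0_pos[of "\<lambda>k. d (Suc k)"] cf0_le_1[of "\<lambda>k. d (Suc k)"] that(1) by blast+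
    then have "real (d 0) + cf0 (\<lambda>k. d (Suc k)) \<le> 4" "0 < real (d 0) + cf0 (\<lambda>k. d (Suc k))"
      using that(2) by linarith+
    then show ?thesis
      by (subst cf0_rec[of d, OF that(1)]) (simp_all add: field_simps)
  qed
  show "1 / 4 \<le> cf0 c"
    using * assms by blast
  have "1 / 4 \<le> cf0 c'"
    by (rule *) fact+
  moreover have "1 \<le> real (c 0)"
    using c[of 0] by linarith
  ultimately have "5 / 4 \<le> real (c 0) + cf0 c'"
    by linarith
  then show "cf0 c \<le> 4 / 5"
    by (subst cf0_rec[of c, OF c]) (simp_all add: c'_def field_simps)
qed

definition fwd :: "(int \<Rightarrow> nat) \<Rightarrow> int \<Rightarrow> nat \<Rightarrow> nat" where
  "fwd a j k = a (j + 1 + int k)"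

definition bwd :: "(int \<Rightarrow> nat) \<Rightarrow> int \<Rightarrow> nat \<Rightarrow> nat" where
  "bwd a j k = a (j - 1 - int k)"

lemma lambda_at_eq:
  assumes "\<And>i. 1 \<le> a i"
  shows "lambda_at a j = real (a j) + cf0 (bwd a j) + cf0 (fwd a j)"
proof -
  have "contfrac (\<lambda>k. a (j + int k)) = real (a j) + cf0 (fwd a j)"
    by (subst contfrac_rec) (auto simp: cf0_def fwd_def[abs_def] add_ac simp del: One_nat_def intro: assms)
  moreover have "contfrac (\<lambda>k. if k = 0 then 0 else a (j - int k)) = cf0 (bwd a j)"
    by (subst contfrac_rec)
      (auto simp: cf0_def bwd_def[abs_def] diff_diff_eq add_ac simp del: One_nat_def intro: assms)
  ultimately show ?thesis
    by (simp add: lambda_at_def)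
qed

lemma fwd_uminus: "fwd (\<lambda>i. a (- i)) j = bwd a (- j)"
  and bwd_uminus: "bwd (\<lambda>i. a (- i)) j = fwd a (- j)"
  by (auto simp: fun_eq_iff fwd_def bwd_def intro!: arg_cong[where f = a])

text \<open>Reflection swaps the two sides, so arguments for one orientation of a word carry over to
  the other.\<close>

lemma lambda_at_uminus:
  assumes "\<And>i. 1 \<le> a i"
  shows "lambda_at (\<lambda>i. a (- i)) j = lambda_at a (- j)"
  using assms by (simp add: lambda_at_eq fwd_uminus bwd_uminus)

lemma digit_le_3:
  assumes "\<And>i. 1 \<le> a i" "lambda_at a j < 4"
  shows "a j \<le> 3"
proof -
  have "real (a j) < 4"
    using lambda_at_eq[of a j] cf0_pos[of "bwd a j"] cf0_pos[of "fwd a j"] assms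
    by (simp add: fwd_def bwd_def)
  then show ?thesis
    by linarith
qed

section \<open>Finite words inside a sequence\<close>

definition agrees :: "int list \<Rightarrow> (nat \<Rightarrow> nat) \<Rightarrow> bool" where
  "agrees xs c \<longleftrightarrow> (\<forall>k<length xs. int (c k) = xs ! k)"

lemma agrees_Nil [simp]: "agrees [] c"
  by (simp add: agrees_def)

lemma agrees_Cons: "agrees (x # xs) c \<longleftrightarrow> int (c 0) = x \<and> agrees xs (\<lambda>k. c (Suc k))"
  by (auto simp: agrees_def less_Suc_eq_0_disj)

lemma agrees_append: "agrees (xs @ ys) c \<longleftrightarrow> agrees xs c \<and> agrees ys (\<lambda>k. c (length xs + k))"
  by (induction xs arbitrary: c) (auto simp: agrees_Cons)

lemma agrees_map: "agrees (map (\<lambda>k. int (c k)) [0..<n]) c"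
  by (simp add: agrees_def)

lemma agrees_prefix: "agrees ys c \<Longrightarrow> prefix xs ys \<Longrightarrow> agrees xs c"
  by (auto simp: prefix_def agrees_append)

lemma agrees_rev:
  "agrees (rev p) (\<lambda>k. a (j - int (length p) + int k)) \<longleftrightarrow> agrees p (bwd a j)"
proof -
  have "(\<forall>k<length p. int (a (j - int (length p) + int k)) = rev p ! k)
    \<longleftrightarrow> (\<forall>k<length p. int (a (j - int (length p) + int (length p - Suc k))) = rev p ! (length p - Suc k))"
    (is "(\<forall>k<_. ?P k) \<longleftrightarrow> (\<forall>k<_. ?P (length p - Suc k))")
  proof (intro iffI allI impI)
    fix k
    assume *: "\<forall>k<length p. ?P (length p - Suc k)" and k: "k < length p"
    have "?P (length p - Suc (length p - Suc k))"
      using *[rule_format, of "length p - Suc k"] k by simp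
    then show "?P k"
      using k by (simp add: Suc_diff_Suc)
  next
    fix k
    assume *: "\<forall>k<length p. ?P k" and k: "k < length p"
    show "?P (length p - Suc k)"
      by (rule *[rule_format]) (use k in simp)
  qed
  also have "\<dots> \<longleftrightarrow> (\<forall>k<length p. int (a (j - 1 - int k)) = p ! k)"
  proof -
    have "j - int (length p) + int (length p - Suc k) = j - 1 - int k" if "k < length p" for k
      using that by linarith
    then show ?thesis
      by (metis (no_types, lifting) rev_nth diff_Suc_less length_greater_0_conv list.size(3) not_less_zero
          rev_rev_ident length_rev)
  qed
  finally show ?thesis
    by (simp add: agrees_def bwd_def)
qed

lemma agrees_around:
  "agrees (rev p @ x # q) (\<lambda>k. a (j - int (length p) + int k))
    \<longleftrightarrow> agrees p (bwd a j) \<and> int (a j) = x \<and> agrees q (fwd a j)"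
  unfolding agrees_append agrees_rev agrees_Cons by (simp add: fwd_def[abs_def] add_ac)

section \<open>Searching for words\<close>

type_synonym bounds = "(int \<times> int) \<times> int \<times> int"

text \<open>Pairs (p, q), (r, s) with p / q \<le> [0; x1, ..., xn, t] \<le> r / s for every tail
  whose value lies in [1/4, 4/5], which is the case as soon as the next two digits are at most 3.\<close>
fun cf_bounds :: "int list \<Rightarrow> bounds" where
  "cf_bounds [] = ((1, 4), (4, 5))"
| "cf_bounds (x # xs) = (case cf_bounds xs of ((p, q), (r, s)) \<Rightarrow> ((s, x * s + r), (q, x * q + p)))"

text \<open>As 1 / (x + t) decreases in t, each further digit swaps the roles of the lower and the
  upper bound. The two digits after the word control the tail at the base.\<close>

lemma cf_bounds:
  assumes "\<And>k. 1 \<le> c k" "agrees xs c" "c (length xs) \<le> 3" "c (Suc (length xs)) \<le> 3"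
    and "cf_bounds xs = ((p, q), (r, s))"
  shows "0 < p \<and> 0 < q \<and> 0 < r \<and> 0 < s \<and> real_of_int p / real_of_int q \<le> cf0 c \<and> cf0 c \<le> real_of_int r / real_of_int s"
  using assms
proof (induction xs arbitrary: c p q r s)
  case Nil
  then show ?case
    using cf0_bounds[of c] by auto
next
  case (Cons x xs)
  obtain p' q' r' s' where b: "cf_bounds xs = ((p', q'), (r', s'))"
    by (metis surj_pair)
  define c' where "c' = (\<lambda>k. c (Suc k))"
  have IH: "0 < p'" "0 < q'" "0 < r'" "0 < s'"
    "real_of_int p' / real_of_int q' \<le> cf0 c'" "cf0 c' \<le> real_of_int r' / real_of_int s'"
    using Cons.IH[of c', OF _ _ _ _ b] Cons.prems by (auto simp: c'_def agrees_Cons)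
  have x: "real_of_int x = real (c 0)" "1 \<le> x"
    using Cons.prems(1)[of 0] Cons.prems(2) by (auto simp: agrees_Cons)
  have rec: "cf0 c = 1 / (x + cf0 c')"
    unfolding c'_def x(1) by (rule cf0_rec) (rule Cons.prems(1))
  have c'_pos: "0 < cf0 c'"
    unfolding c'_def by (rule cf0_pos) (rule Cons.prems(1))
  have eqs: "p = s'" "q = x * s' + r'" "r = q'" "s = x * q' + p'"
    using Cons.prems(5) b by auto
  have "real_of_int s' / (x * s' + r') = 1 / (x + r' / s')" "real_of_int q' / (x * q' + p') = 1 / (x + p' / q')"
    using IH(1-4) x(2) by (simp_all add: field_simps)
  moreover have "1 / (x + r' / s') \<le> cf0 c"
    unfolding rec using IH c'_pos x(2) by (intro divide_left_mono mult_pos_pos add_pos_pos) auto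
  moreover have "cf0 c \<le> 1 / (x + p' / q')"
    unfolding rec using IH c'_pos x(2) by (intro divide_left_mono mult_pos_pos add_pos_pos) auto
  moreover have "0 < x * s' + r'" "0 < x * q' + p'"
    using IH(1-4) x(2) by (auto intro!: add_pos_pos)
  ultimately show ?case
    using IH(1-4) unfolding eqs by simp
qed

text \<open>Denominators are cleared, so that only exact integer arithmetic is evaluated. The centre
  digit is left out of the sum.\<close>

definition above :: "int \<Rightarrow> int \<Rightarrow> bounds \<Rightarrow> bounds \<Rightarrow> bool" where
  "above N D I J = (case I of ((p, q), _) \<Rightarrow> case J of ((p', q'), _) \<Rightarrow>
     N * (q * q') \<le> D * (p * q' + p' * q))"

definition below :: "int \<Rightarrow> int \<Rightarrow> bounds \<Rightarrow> bounds \<Rightarrow> bool" where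
  "below N D I J = (case I of (_, (r, s)) \<Rightarrow> case J of (_, (r', s')) \<Rightarrow>
     D * (r * s' + r' * s) \<le> N * (s * s'))"

lemma
  assumes a: "\<And>i. 1 \<le> a i" and D: "0 < D"
    and agr: "agrees u (bwd a j)" "agrees v (fwd a j)"
    and small: "\<And>i. j - int (length u) - 2 \<le> i \<Longrightarrow> i \<le> j + int (length v) + 2 \<Longrightarrow> a i \<le> 3"
  shows above: "above N D (cf_bounds u) (cf_bounds v) \<Longrightarrow> real (a j) + real_of_int N / real_of_int D \<le> lambda_at a j"
    and below: "below N D (cf_bounds u) (cf_bounds v) \<Longrightarrow> lambda_at a j \<le> real (a j) + real_of_int N / real_of_int D"
proof -
  obtain p q r s where u: "cf_bounds u = ((p, q), (r, s))"
    by (metis surj_pair)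
  obtain p' q' r' s' where v: "cf_bounds v = ((p', q'), (r', s'))"
    by (metis surj_pair)
  have U: "0 < p \<and> 0 < q \<and> 0 < r \<and> 0 < s \<and> real_of_int p / real_of_int q \<le> cf0 (bwd a j)
      \<and> cf0 (bwd a j) \<le> real_of_int r / real_of_int s"
    by (rule cf_bounds[OF _ agr(1) _ _ u]) (auto simp: bwd_def simp del: One_nat_def intro!: a small)
  have V: "0 < p' \<and> 0 < q' \<and> 0 < r' \<and> 0 < s' \<and> real_of_int p' / real_of_int q' \<le> cf0 (fwd a j)
      \<and> cf0 (fwd a j) \<le> real_of_int r' / real_of_int s'"
    by (rule cf_bounds[OF _ agr(2) _ _ v]) (auto simp: fwd_def simp del: One_nat_def intro!: a small)
  note eq = lambda_at_eq[where a = a and j = j, OF a]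
  {
    assume "above N D (cf_bounds u) (cf_bounds v)"
    then have "real_of_int (N * (q * q')) \<le> real_of_int (D * (p * q' + p' * q))"
      unfolding u v above_def by (simp only: prod.case of_int_le_iff)
    then have "real_of_int N / D \<le> real_of_int p / q + real_of_int p' / q'"
      using U V D by (simp add: field_simps)
    then show "real (a j) + real_of_int N / D \<le> lambda_at a j"
      using U V eq by linarith
  }
  {
    assume "below N D (cf_bounds u) (cf_bounds v)"
    then have "real_of_int (D * (r * s' + r' * s)) \<le> real_of_int (N * (s * s'))"
      unfolding u v below_def by (simp only: prod.case of_int_le_iff)
    then have "real_of_int r / s + real_of_int r' / s' \<le> real_of_int N / D"
      using U V D by (simp add: field_simps)
    then show "lambda_at a j \<le> real (a j) + real_of_int N / D"
      using U V eq by linarith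
  }
qed

text \<open>All continuations of the digits u (to the left, read from right to left) and v (to the
  right) around a digit 3 either have a lambda of at least 3 + M / D somewhere, or a lambda of at
  most 3 + N / D at the centre, or reach one of the goals in gs. The side whose continued fraction has the smaller
  denominator is extended, as it is known less precisely; a huge weight c extends to the left only.
  The recursion uses if instead of Boolean connectives to make the simplifier evaluate lazily.\<close>
fun search :: "int \<Rightarrow> int \<Rightarrow> int \<Rightarrow> int \<Rightarrow> int list list \<Rightarrow> (int list \<times> int list) list \<Rightarrow> nat \<Rightarrow>
    int list \<Rightarrow> int list \<Rightarrow> bounds \<Rightarrow> bounds \<Rightarrow> bool" where
  "search c N M D fs gs 0 u v I J = False"
| "search c N M D fs gs (Suc n) u v I J =
   (if above M D I J then True else
    if below N D I J then True else
    if list_ex (\<lambda>xs. prefix xs (rev u @ 3 # v)) fs then True else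
    if list_ex (\<lambda>xs. prefix xs (rev v @ 3 # u)) fs then True else
    if list_ex (\<lambda>(p, q). prefix p u \<and> prefix q v) gs then True else
    if snd (fst I) \<le> c * snd (fst J) then
      (if search c N M D fs gs n (u @ [1]) v (cf_bounds (u @ [1])) J then
       if search c N M D fs gs n (u @ [2]) v (cf_bounds (u @ [2])) J then
         search c N M D fs gs n (u @ [3]) v (cf_bounds (u @ [3])) J
       else False else False)
    else
      (if search c N M D fs gs n u (v @ [1]) I (cf_bounds (v @ [1])) then
       if search c N M D fs gs n u (v @ [2]) I (cf_bounds (v @ [2])) then
         search c N M D fs gs n u (v @ [3]) I (cf_bounds (v @ [3]))
       else False else False))"

definition excluded :: "int \<Rightarrow> int \<Rightarrow> int list \<Rightarrow> bool" where
  "excluded M D xs \<longleftrightarrow> (\<exists>p q. xs = rev p @ 3 # q \<and> above M D (cf_bounds p) (cf_bounds q))"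

text \<open>The control of lambda reaches two positions beyond each end: lambda below 4 keeps the
  digits there at most 3, as the tail bounds require.\<close>

lemma excluded:
  assumes a: "\<And>i. 1 \<le> a i" and D: "0 < D" "M < D" and "excluded M D xs"
    and agr: "agrees xs (\<lambda>k. a (i + int k))"
    and small: "\<And>k. i - 2 \<le> k \<Longrightarrow> k \<le> i + int (length xs) + 2 \<Longrightarrow> lambda_at a k < 3 + real_of_int M / real_of_int D"
  shows False
proof -
  obtain p q where xs: "xs = rev p @ 3 # q" and pq: "above M D (cf_bounds p) (cf_bounds q)"
    using \<open>excluded M D xs\<close> by (auto simp: excluded_def)
  define j where "j = i + int (length p)"
  have "agrees p (bwd a j) \<and> int (a j) = 3 \<and> agrees q (fwd a j)"
    using agr agrees_around[of p 3 q a j] by (simp add: xs j_def)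
  moreover have "real_of_int M / real_of_int D < 1"
    using D by simp
  then have "a k \<le> 3" if "j - int (length p) - 2 \<le> k" "k \<le> j + int (length q) + 2" for k
    using small[of k] that by (intro digit_le_3 a) (auto simp: j_def xs)
  ultimately have "real (a j) + real_of_int M / real_of_int D \<le> lambda_at a j" "a j = 3"
    using above[where a = a and j = j, OF a D(1) _ _ _ pq] by auto
  moreover have "lambda_at a j < 3 + real_of_int M / real_of_int D"
    by (rule small) (auto simp: j_def xs)
  ultimately show False
    by simp
qed

text \<open>Induction on the fuel: the hypotheses refute every pruning, and of the three branches
  the one with the actual next digit is followed. Each step reads one digit, so the controlled
  window exceeds the known words by \<open>n\<close>, plus two for the tail bounds.\<close>

lemma search:
  assumes a: "\<And>i. 1 \<le> a i" and D: "0 < D" "M < D" and fs: "\<And>xs. xs \<in> set fs \<Longrightarrow> excluded M D xs"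
    and "a j = 3" and large: "3 + real_of_int N / real_of_int D < lambda_at a j"
    and "agrees u (bwd a j)" "agrees v (fwd a j)"
    and "\<And>i. j - int (length u) - int n - 2 \<le> i \<Longrightarrow> i \<le> j + int (length v) + int n + 2
          \<Longrightarrow> lambda_at a i < 3 + real_of_int M / real_of_int D"
    and "search c N M D fs gs n u v (cf_bounds u) (cf_bounds v)"
  shows "\<exists>(p, q) \<in> set gs. agrees p (bwd a j) \<and> agrees q (fwd a j)"
  using assms(7-)
proof (induction n arbitrary: u v)
  case (Suc n)
  note agr = Suc.prems(1,2) and small = Suc.prems(3)
  have "real_of_int M / real_of_int D < 1"
    using D by simp
  then have le_3: "a i \<le> 3" if "j - int (length u) - int n - 3 \<le> i" "i \<le> j + int (length v) + int n + 3" for i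
    using small[of i] that by (intro digit_le_3 a) auto
  have not_above: "\<not> above M D (cf_bounds u) (cf_bounds v)"
    using above[where a = a and j = j, OF a D(1) agr le_3] small[of j] \<open>a j = 3\<close> by fastforce
  have not_below: "\<not> below N D (cf_bounds u) (cf_bounds v)"
    using below[where a = a and j = j, OF a D(1) agr le_3] large \<open>a j = 3\<close> by fastforce
  have not_left: "\<not> list_ex (\<lambda>xs. prefix xs (rev u @ 3 # v)) fs"
  proof
    assume "list_ex (\<lambda>xs. prefix xs (rev u @ 3 # v)) fs"
    then obtain xs where xs: "xs \<in> set fs" "prefix xs (rev u @ 3 # v)"
      by (auto simp: list_ex_iff)
    then have "agrees xs (\<lambda>k. a (j - int (length u) + int k))"
      using agr \<open>a j = 3\<close> by (intro agrees_prefix[OF _ xs(2)]) (simp add: agrees_around)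
    moreover have "length xs \<le> length u + length v + 1"
      using prefix_length_le[OF xs(2)] by simp
    ultimately show False
      using excluded[where a = a and xs = xs, OF a D fs[OF xs(1)], where i = "j - int (length u)"] small by fastforce
  qed
  have not_right: "\<not> list_ex (\<lambda>xs. prefix xs (rev v @ 3 # u)) fs"
  proof
    assume "list_ex (\<lambda>xs. prefix xs (rev v @ 3 # u)) fs"
    then obtain xs where xs: "xs \<in> set fs" "prefix xs (rev v @ 3 # u)"
      by (auto simp: list_ex_iff)
    \<comment> \<open>A window read from right to left is a window of the reflected
      sequence.\<close>
    then have "agrees xs (\<lambda>k. a (- (- j - int (length v) + int k)))"
      using agr \<open>a j = 3\<close> agrees_around[where a = "\<lambda>i. a (- i)" and j = "- j" and p = v and q = u and x = 3]
      by (intro agrees_prefix[OF _ xs(2)]) (simp add: fwd_uminus bwd_uminus)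
    moreover have "length xs \<le> length u + length v + 1"
      using prefix_length_le[OF xs(2)] by simp
    ultimately show False
      using excluded[where a = "\<lambda>i. a (- i)" and xs = xs, OF a D fs[OF xs(1)], where i = "- j - int (length v)"] small a
      by (fastforce simp: lambda_at_uminus)
  qed
  show ?case
  proof (cases "list_ex (\<lambda>(p, q). prefix p u \<and> prefix q v) gs")
    case True
    then obtain p q where "(p, q) \<in> set gs" "prefix p u" "prefix q v"
      by (auto simp: list_ex_iff)
    then show ?thesis
      using agrees_prefix[OF agr(1)] agrees_prefix[OF agr(2)] by blast
  next
    case no_goal: False
    show ?thesis
    proof (cases "snd (fst (cf_bounds u)) \<le> c * snd (fst (cf_bounds v))")
      case True
      define x where "x = int (bwd a j (length u))"
      have x: "x \<in> {1, 2, 3}"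
        using a[of "j - 1 - int (length u)"] le_3[of "j - 1 - int (length u)"] by (auto simp: x_def bwd_def)
      have "search c N M D fs gs n (u @ [x]) v (cf_bounds (u @ [x])) (cf_bounds v)"
        using Suc.prems(4) x not_above not_below not_left not_right no_goal True by (auto split: if_splits)
      moreover have "agrees (u @ [x]) (bwd a j)"
        using agr by (simp add: agrees_append agrees_Cons x_def)
      ultimately show ?thesis
        using agr small by (intro Suc.IH[of "u @ [x]" v]) auto
    next
      case False
      define x where "x = int (fwd a j (length v))"
      have x: "x \<in> {1, 2, 3}"
        using a[of "j + 1 + int (length v)"] le_3[of "j + 1 + int (length v)"] by (auto simp: x_def fwd_def)
      have "search c N M D fs gs n u (v @ [x]) (cf_bounds u) (cf_bounds (v @ [x]))"
        using Suc.prems(4) x not_above not_below not_left not_right no_goal False by (auto split: if_splits)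
      moreover have "agrees (v @ [x]) (fwd a j)"
        using agr by (simp add: agrees_append agrees_Cons x_def)
      ultimately show ?thesis
        using agr small by (intro Suc.IH[of u "v @ [x]"]) auto
    qed
  qed
qed simp

text \<open>A pair (p, q) stands for the word with centre 3, with p to the left of the centre, read from
  right to left, and q to its right. Whatever the further digits, lambda at the centre is at least
  the upper threshold. These are the words that prune the searches below.\<close>
definition too_large :: "(int list \<times> int list) list" where
  "too_large =
  [([1], [1]),
   ([], [1,2]),
   ([], [1,3]),
   ([2,2], [1]),
   ([2,3], [1]),
   ([1,1,1], [2]),
   ([2], [1,1,2,2]),
   ([2], [1,1,2,3]),
   ([2,1,1], [1,1,2]),
   ([2,1,1], [1,1,3,3]),
   ([1,1,1,3], [3,3,1]),
   ([1,1,2], [2,1,2,1,1]),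
   ([3,3,2,3], [1,1,1,3]),
   ([2,1,1,1,2], [1,1,3,2]),
   ([3,3,2,2], [1,1,1,3,3]),
   ([3,3,2,1,1], [1,1,1,3,3,3]),
   ([3,3,2,1,1,2], [1,1,1,3,3,2]),
   ([3,3,2,1,1,3], [1,1,1,3,3,2]),
   ([3,3,2,1,1,1,1], [1,1,1,3,3,2]),
   ([3,3,2,1,1,1,2], [1,1,1,3,3,2,2]),
   ([3,3,2,1,1,1,2,3], [1,1,1,3,3,2,3]),
   ([3,3,2,1,1,1,2,2], [1,1,1,3,3,2,3,2]),
   ([3,3,2,1,1,1,2,1,2], [1,1,1,3,3,2,3,3]),
   ([3,3,2,1,1,1,2,1,1], [1,1,1,3,3,2,3,2,1]),
   ([3,3,2,1,1,1,2,1,2,3,1], [1,1,1,3,3,2,3,2,1,2,1]),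
   ([3,3,2,1,1,1,2,1,2,3,2,3], [1,1,1,3,3,2,3,2,1,2,1,2]),
   ([3,3,2,1,1,1,2,1,2,3,2,3], [1,1,1,3,3,2,3,2,1,2,1,1,1,3]),
   ([3,3,2,1,1,1,2,1,2,3,2,3], [1,1,1,3,3,2,3,2,1,2,1,1,1,2,1]),
   ([3,3,2,1,1,1,2,1,2,3,2,3], [1,1,1,3,3,2,3,2,1,2,1,1,1,2,2]),
   ([3,3,2,1,1,1,2,1,2,3,2,3,3,1,1], [1,1,1,3,3,2,3,2,1,2,1,1,1,2,3,3,1])]"

text \<open>Closed under reversal, since the search compares only the beginnings of the window read
  from the left and from the right; a newly added digit always lies at one of these ends.\<close>

definition forbidden :: "int list list" where
  "forbidden = concat (map (\<lambda>(p, q). [rev p @ 3 # q, rev q @ 3 # p]) too_large)"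

text \<open>m1 - 3 truncated to 24 decimals, and two units of the last place more.\<close>

abbreviation "lower_num \<equiv> 942001159911341469214374 :: int"
abbreviation "upper_num \<equiv> 942001159911341469214376 :: int"
abbreviation "den \<equiv> 10 ^ 24 :: int"

lemma above_commute: "above N D I J \<longleftrightarrow> above N D J I"
  by (auto simp: above_def mult.commute add.commute split: prod.splits)

lemma excluded_forbidden:
  assumes "xs \<in> set forbidden"
  shows "excluded upper_num den xs"
proof -
  have "list_all (\<lambda>(p, q). above upper_num den (cf_bounds p) (cf_bounds q)) too_large"
    by code_simp
  moreover obtain p q where "(p, q) \<in> set too_large" "xs = rev p @ 3 # q \<or> xs = rev q @ 3 # p"
    using assms by (auto simp: forbidden_def)
  ultimately show ?thesis
    using above_commute unfolding list_all_iff excluded_def by fast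
qed

text \<open>The digits of the sequence of m1 to the left (read from right to left) and to the right of
  position 0, and those to the right of position -17.\<close>
definition left29 :: "int list" where
  "left29 = [3, 3, 2, 1, 1, 1, 2, 1, 2, 3, 2, 3, 3, 1, 1, 1, 3, 3, 3, 2, 1, 1, 1, 2, 1, 2, 3, 2, 3]"

definition right31 :: "int list" where
  "right31 = [1, 1, 1, 3, 3, 2, 3, 2, 1, 2, 1, 1, 1, 2, 3, 3, 3, 1, 1, 1, 3, 3, 2, 3, 2, 1, 2, 1, 1, 1, 1]"

definition right34 :: "int list" where
  "right34 = [1, 1, 1, 3, 3, 2, 3, 2, 1, 2, 1, 1, 1, 2, 3, 3, 3, 1, 1, 1, 3, 3, 2, 3, 2, 1, 2, 1, 1, 1, 2, 3, 3, 3]"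

text \<open>Fixes the orientation. The two goals are mirror images, so only one of them is searched
  further.\<close>

lemma search_centre:
  "search 1 lower_num upper_num den forbidden [([3], [1]), ([1], [3])] 40 [] [] (cf_bounds []) (cf_bounds [])"
  by code_simp

text \<open>The lower threshold 3 - 1 / D never prunes.\<close>
lemma search_replication:
  "search (10 ^ 10) (- 1) upper_num den forbidden [(left29, [])] 45 (take 12 left29) right34
     (cf_bounds (take 12 left29)) (cf_bounds right34)"
  by code_simp

lemma search_main:
  "search 1 lower_num upper_num den forbidden [(left29, right31)] 70 [3] [1] (cf_bounds [3]) (cf_bounds [1])"
  by code_simp

section \<open>Local uniqueness and self-replication\<close>

lemma agrees_nth: "agrees xs c \<Longrightarrow> k < length xs \<Longrightarrow> int (c k) = xs ! k"
  by (simp add: agrees_def)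

text \<open>A digit at most 2 would give at most 2 + 4/5 + 4/5 = 18/5.\<close>

lemma digit_eq_3:
  assumes a: "\<And>i. 1 \<le> a i"
    and small: "\<And>i. j - 2 \<le> i \<Longrightarrow> i \<le> j + 2 \<Longrightarrow> lambda_at a i < 4"
    and large: "18 / 5 < lambda_at a j"
  shows "a j = 3"
proof -
  have le_3: "a i \<le> 3" if "j - 2 \<le> i" "i \<le> j + 2" for i
    by (rule digit_le_3) (use a small that in auto)
  have "cf0 (bwd a j) \<le> 4 / 5" "cf0 (fwd a j) \<le> 4 / 5"
    by (rule cf0_bounds; use a le_3 in \<open>auto simp: bwd_def fwd_def\<close>)+
  then have "2 < real (a j)"
    using large lambda_at_eq[where a = a and j = j, OF a] by linarith
  then show ?thesis
    using le_3[of j] by linarith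
qed

definition upper :: real where "upper = 3 + real_of_int upper_num / real_of_int den"
definition lower :: real where "lower = 3 + real_of_int lower_num / real_of_int den"

definition centred :: "(int \<Rightarrow> nat) \<Rightarrow> int \<Rightarrow> bool" where
  "centred a j \<longleftrightarrow> a j = 3 \<and> agrees left29 (bwd a j) \<and> agrees right31 (fwd a j)"

text \<open>\<open>search_centre\<close> decides the orientation, \<open>search_main\<close> then
  determines the digits. The radius 80 covers the 70 steps of the longer search, its initial digit
  and two more.\<close>

lemma local_uniqueness:
  assumes a: "\<And>i. 1 \<le> a i" and small: "\<And>i. j - 80 \<le> i \<Longrightarrow> i \<le> j + 80 \<Longrightarrow> lambda_at a i < upper"
    and large: "lower < lambda_at a j"
  shows "centred a j \<or> centred (\<lambda>i. a (- i)) (- j)"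
proof -
  \<comment> \<open>Stated for an arbitrary sequence, to be used for \<open>a\<close> and for its
    reflection.\<close>
  have main: "centred b i"
    if b: "\<And>i. 1 \<le> b i" and small: "\<And>k. i - 80 \<le> k \<Longrightarrow> k \<le> i + 80 \<Longrightarrow> lambda_at b k < upper"
      and large: "lower < lambda_at b i" and "b i = 3" "agrees [3] (bwd b i)" "agrees [1] (fwd b i)" for b i
  proof -
    have "\<exists>(p, q) \<in> set [(left29, right31)]. agrees p (bwd b i) \<and> agrees q (fwd b i)"
      by (rule search[where a = b and j = i, OF b _ _ excluded_forbidden \<open>b i = 3\<close> large[unfolded lower_def]
            \<open>agrees [3] _\<close> \<open>agrees [1] _\<close> _ search_main])
        (use small in \<open>auto simp: upper_def\<close>)
    then show ?thesis
      using \<open>b i = 3\<close> by (simp add: centred_def)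
  qed
  have "upper < 4" "18 / 5 < lower"
    by (simp_all add: upper_def lower_def)
  then have "a j = 3"
    using large by (intro digit_eq_3 a) (auto intro: less_trans[OF small])
  have "\<exists>(p, q) \<in> set [([3], [1]), ([1], [3])]. agrees p (bwd a j) \<and> agrees q (fwd a j)"
    by (rule search[where a = a and j = j, OF a _ _ excluded_forbidden \<open>a j = 3\<close> large[unfolded lower_def] agrees_Nil
          agrees_Nil _ search_centre])
      (use small in \<open>auto simp: upper_def\<close>)
  then consider "agrees [3] (bwd a j)" "agrees [1] (fwd a j)" | "agrees [1] (bwd a j)" "agrees [3] (fwd a j)"
    by auto
  then show ?thesis
  proof cases
    case 1
    then show ?thesis
      using main[of a j] a small large \<open>a j = 3\<close> by blast
  next
    case 2
    have "centred (\<lambda>i. a (- i)) (- j)"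
      using 2 \<open>a j = 3\<close> a small large by (intro main) (auto simp: fwd_uminus bwd_uminus lambda_at_uminus)
    then show ?thesis
      by blast
  qed
qed

text \<open>Digits -12, ..., 34 of the periodic sequence of w around a marked digit.\<close>
definition block :: "int list" where
  "block = rev (take 12 left29) @ 3 # right34"

definition block_at :: "(int \<Rightarrow> nat) \<Rightarrow> int \<Rightarrow> bool" where
  "block_at a i \<longleftrightarrow> agrees block (\<lambda>k. a (i - 12 + int k))"

lemma block_at_iff:
  "block_at a i \<longleftrightarrow> agrees (take 12 left29) (bwd a i) \<and> a i = 3 \<and> agrees right34 (fwd a i)"
proof -
  have "length (take 12 left29) = 12"
    by code_simp
  then show ?thesis
    using agrees_around[of "take 12 left29" 3 right34 a i] by (auto simp: block_at_def block_def)
qed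

text \<open>29 = 12 + 17: the known digits on the left reach exactly to the start of the block
  around \<open>i - 17\<close>.\<close>

lemma block_at_extend:
  assumes "agrees left29 (bwd a i)" "a i = 3" "agrees q (fwd a i)" and "prefix block (rev left29 @ 3 # q)"
  shows "block_at a (i - 17)"
proof -
  have "length left29 = 29"
    by code_simp
  then have "agrees (rev left29 @ 3 # q) (\<lambda>k. a (i - 29 + int k))"
    using agrees_around[of left29 3 q a i] assms(1-3) by simp
  then show ?thesis
    using agrees_prefix[OF _ assms(4)] by (simp add: block_at_def)
qed

text \<open>\<open>search_replication\<close> prolongs the 12 left digits by a full period of
  17.\<close>

lemma block_at_shift:
  assumes a: "\<And>i. 1 \<le> a i" and small: "\<And>k. i - 60 \<le> k \<Longrightarrow> k \<le> i + 90 \<Longrightarrow> lambda_at a k < upper"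
    and "block_at a i"
  shows "block_at a (i - 17)"
proof -
  have B: "agrees (take 12 left29) (bwd a i)" "a i = 3" "agrees right34 (fwd a i)"
    using \<open>block_at a i\<close> by (auto simp: block_at_iff)
  have len: "length (take 12 left29) = 12" "length right34 = 34"
    by code_simp+
  have large: "3 + real_of_int (- 1) / real_of_int den < lambda_at a i"
    using lambda_at_eq[where a = a and j = i, OF a] cf0_pos[of "bwd a i"] cf0_pos[of "fwd a i"] a B(2)
    by (simp add: fwd_def bwd_def)
  have "\<exists>(p, q) \<in> set [(left29, [])]. agrees p (bwd a i) \<and> agrees q (fwd a i)"
    by (rule search[where a = a and j = i, OF a _ _ excluded_forbidden B(2) large B(1,3) _ search_replication])
      (use small in \<open>auto simp: upper_def len\<close>)
  then have "agrees left29 (bwd a i)"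
    by simp
  moreover have "prefix block (rev left29 @ 3 # right34)"
    by code_simp
  ultimately show ?thesis
    using B by (intro block_at_extend)
qed

lemma block_at_iterate:
  assumes a: "\<And>i. 1 \<le> a i" and small: "\<And>k. lo \<le> k \<Longrightarrow> k \<le> i + 90 \<Longrightarrow> lambda_at a k < upper"
    and "block_at a i" "lo \<le> i - 17 * int n - 60"
  shows "block_at a (i - 17 * int n)"
  using assms(4)
proof (induction n)
  case (Suc n)
  then have "block_at a (i - 17 * int n - 17)"
    by (intro block_at_shift a small) auto
  then show ?case
    by (simp add: algebra_simps)
qed (use assms in auto)

text \<open>A block has 47 = 30 + 17 digits and so displays the period at 30 places. The 17 of them
  from \<open>i\<close> on are enough for blocks one period apart to leave no gap.\<close>

lemma block_at_periodic:
  assumes "block_at a i" "i \<le> p" "p \<le> i + 16"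
  shows "a (p + 17) = a p"
proof -
  define k where "k = nat (p - i + 12)"
  have k: "k < 30" "i - 12 + int k = p" "i - 12 + int (k + 17) = p + 17"
    using assms(2,3) by (auto simp: k_def)
  have "length block = 47" "list_all (\<lambda>k. block ! k = block ! (k + 17)) [0..<30]"
    by code_simp+
  then have "int (a (i - 12 + int k)) = int (a (i - 12 + int (k + 17)))"
    using k(1) agrees_nth[OF \<open>block_at a i\<close>[unfolded block_at_def], of k]
      agrees_nth[OF \<open>block_at a i\<close>[unfolded block_at_def], of "k + 17"]
    by (simp add: list_all_iff del: of_nat_add)
  then show ?thesis
    unfolding k by simp
qed

lemma periodic_before_centred:
  assumes a: "\<And>i. 1 \<le> a i" and small: "\<And>k. lo \<le> k \<Longrightarrow> k \<le> j + 90 \<Longrightarrow> lambda_at a k < upper"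
    and "centred a j" "lo + 100 \<le> p" "p \<le> j - 60"
  shows "a (p + 17) = a p"
proof -
  \<comment> \<open>\<open>i\<close> becomes the position congruent to \<open>j\<close> modulo 17
    with \<open>p\<close> among \<open>i\<close>, ..., \<open>i + 16\<close>.\<close>
  define n where "n = nat ((j - 1 - p) div 17)"
  define i where "i = j - 17 - 17 * int n"
  have n: "int n = (j - 1 - p) div 17"
    using assms(5) by (simp add: n_def)
  have i: "i \<le> p" "p \<le> i + 16"
    unfolding i_def n by linarith+
  have "prefix block (rev left29 @ 3 # right31)"
    by code_simp
  \<comment> \<open>The first block sits one period before \<open>j\<close>: around \<open>j\<close>
    itself, the last digit of \<open>right31\<close> differs from that of the period.\<close>
  then have "block_at a (j - 17)"
    using \<open>centred a j\<close> by (intro block_at_extend) (auto simp: centred_def)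
  then have "block_at a i"
    unfolding i_def
    by (intro block_at_iterate[where lo = lo] a small) (use i assms(4) in \<open>auto simp: i_def\<close>)
  then show ?thesis
    using i by (rule block_at_periodic)
qed

text \<open>The offsets 14 and 31 belong to the digits after two successive 12111: first the 2 of w,
  then the 1 where the sequence of m1 departs from the period.\<close>

lemma centred_not_periodic:
  assumes "centred a j"
  shows "a (j + 14) \<noteq> a (j + 31)"
proof -
  have "length right31 = 31" "right31 ! 13 = 2" "right31 ! 30 = 1"
    by code_simp+
  then have "int (a (j + 14)) = 2" "int (a (j + 31)) = 1"
    using agrees_nth[of right31 "fwd a j" 13] agrees_nth[of right31 "fwd a j" 30] assms
    by (simp_all add: centred_def fwd_def add.assoc)
  then show ?thesis
    by simp
qed

text \<open>If \<open>j\<close> were centred, the period would extend to the left past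
  \<open>i\<close>. But \<open>i\<close> is centred in one of the two orientations, and either one
  breaks the period near \<open>i\<close>.\<close>

lemma not_centred:
  assumes a: "\<And>i. 1 \<le> a i" and small: "\<And>k. i - 200 \<le> k \<Longrightarrow> k \<le> j + 200 \<Longrightarrow> lambda_at a k < upper"
    and "lower < lambda_at a i" "i + 200 \<le> j"
  shows "\<not> centred a j"
proof
  assume "centred a j"
  then have per: "a (p + 17) = a p" if "i - 100 \<le> p" "p \<le> j - 60" for p
    by (intro periodic_before_centred[where a = a and lo = "i - 200" and j = j, OF a])
      (use small that in auto)
  have "centred a i \<or> centred (\<lambda>i. a (- i)) (- i)"
    by (rule local_uniqueness) (use assms in auto)
  \<comment> \<open>The conflicting pairs are \<open>i + 14\<close>, \<open>i + 31\<close> and, in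
    the reflected case, \<open>i - 31\<close>, \<open>i - 14\<close>.\<close>
  then show False
    using centred_not_periodic[of a i] centred_not_periodic[of "\<lambda>i. a (- i)" "- i"]
      per[of "i + 14"] per[of "i - 31"] assms(4)
    by (auto simp: algebra_simps)
qed

section \<open>Exclusion from the Lagrange spectrum\<close>

lemma not_in_lagrange_spectrum:
  assumes "lower < x" "x < upper"
  shows "x \<notin> lagrange_spectrum"
proof
  assume "x \<in> lagrange_spectrum"
  then obtain a where a: "\<And>i. 1 \<le> a i" and x: "Limsup at_top (\<lambda>j. ereal (lambda_at a j)) = ereal x"
    by (auto simp: lagrange_spectrum_def lagrange_value_def)
  have "\<forall>\<^sub>F j in at_top. ereal (lambda_at a j) < ereal upper"
    using assms(2) x by (intro Limsup_lessD) simp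
  then obtain J where J: "\<And>j. J \<le> j \<Longrightarrow> lambda_at a j < upper"
    by (auto simp: eventually_at_top_linorder)
  have often: "\<exists>j\<ge>i. lower < lambda_at a j" for i
  proof (rule ccontr)
    assume "\<not> (\<exists>j\<ge>i. lower < lambda_at a j)"
    then have "\<forall>\<^sub>F j in at_top. ereal (lambda_at a j) \<le> ereal lower"
      by (auto simp: eventually_at_top_linorder not_less)
    then have "ereal x \<le> ereal lower"
      unfolding x[symmetric] by (rule Limsup_bounded)
    then show False
      using assms(1) by simp
  qed
  \<comment> \<open>Three distant positions: the earlier one prevents the middle one from being
    centred, and the later one does the same in the reflected sequence.\<close>
  obtain i where i: "J + 200 \<le> i" "lower < lambda_at a i"
    using often by blast
  obtain j where j: "i + 200 \<le> j" "lower < lambda_at a j"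
    using often by blast
  obtain k where k: "j + 200 \<le> k" "lower < lambda_at a k"
    using often by blast
  have "\<not> centred a j"
    by (rule not_centred[where i = i]) (use a i j J in auto)
  moreover have "\<not> centred (\<lambda>i. a (- i)) (- j)"
    by (rule not_centred[where i = "- k"]) (use a i j k J in \<open>auto simp: lambda_at_uminus\<close>)
  moreover have "centred a j \<or> centred (\<lambda>i. a (- i)) (- j)"
    by (rule local_uniqueness) (use a i j J in auto)
  ultimately show False
    by blast
qed

section \<open>The sequences of m1 and j0\<close>

lemma biinfinite_bounds:
  assumes "\<And>x. x \<in> set u \<union> set c \<union> set v \<Longrightarrow> 1 \<le> x \<and> x \<le> 3" "u \<noteq> []" "v \<noteq> []"
  shows "1 \<le> biinfinite u c k v i" "biinfinite u c k v i \<le> 3"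
proof -
  have "biinfinite u c k v i \<in> set u \<union> set c \<union> set v"
    using assms(2,3) by (auto simp: biinfinite_def Let_def nat_less_iff intro!: nth_mem)
  then show "1 \<le> biinfinite u c k v i" "biinfinite u c k v i \<le> 3"
    using assms(1) by blast+
qed

lemma j0_seq_bounds: "1 \<le> j0_seq i" "j0_seq i \<le> 3"
  unfolding j0_seq_def by (rule biinfinite_bounds; auto simp: w_def)+

lemma m1_seq_bounds: "1 \<le> m1_seq i" "m1_seq i \<le> 3"
  unfolding m1_seq_def by (rule biinfinite_bounds; auto simp: w_def)+

lemma length_w [simp]: "length w = 17"
  by (simp add: w_def)

lemma j0_seq_eq: "j0_seq i = w ! nat ((i + 8) mod 17)"
proof -
  define p where "p = i + 8"
  have "j0_seq i = (if p < 0 then w ! nat (p mod 17) else if p < 17 then w ! nat p else w ! nat ((p - 17) mod 17))"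
    by (simp add: p_def j0_seq_def biinfinite_def Let_def)
  also have "\<dots> = w ! nat (p mod 17)"
    by simp
  finally show ?thesis
    by (simp add: p_def)
qed

lemma j0_seq_mod: "j0_seq (i mod 17 + d) = j0_seq (i + d)"
  unfolding j0_seq_eq by (simp add: mod_simps add.assoc)

text \<open>26 = 34 - 8 is the position just after the second w of the central word.\<close>

lemma m1_seq_eq_j0_seq:
  assumes "i < 26"
  shows "m1_seq i = j0_seq i"
proof -
  consider "i + 8 < 0" | "0 \<le> i + 8" "i + 8 < 17" | "17 \<le> i + 8" "i + 8 < 34"
    using assms by linarith
  then show ?thesis
  proof cases
    case 1
    then show ?thesis
      by (simp add: m1_seq_def j0_seq_eq biinfinite_def)
  next
    case 2
    then have "nat (i + 8) < 17" "(i + 8) mod 17 = i + 8"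
      by auto
    with 2 show ?thesis
      by (simp add: m1_seq_def j0_seq_eq biinfinite_def nth_append)
  next
    case 3
    then have *: "nat (i + 8) - 17 < 17" "17 \<le> nat (i + 8)"
      by linarith+
    have "(i + 8) mod 17 = (i + 8 - 17) mod 17"
      by (rule minus_mod_self2[symmetric])
    also have "\<dots> = i + 8 - 17"
      using 3 by (intro mod_pos_pos_trivial) linarith+
    finally have "nat ((i + 8) mod 17) = nat (i + 8) - 17"
      using 3 by linarith
    with 3 * show ?thesis
      by (simp add: m1_seq_def j0_seq_eq biinfinite_def Let_def nth_append)
  qed
qed

lemma m1_seq_tail:
  assumes "33 \<le> i"
  shows "m1_seq i = [2, 3] ! nat ((i - 33) mod 2)"
  using assms by (simp add: m1_seq_def biinfinite_def Let_def)

section \<open>Evaluation on finite windows\<close>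

definition bwords :: "(int \<Rightarrow> nat) \<Rightarrow> int \<Rightarrow> nat \<Rightarrow> int list" where
  "bwords a j n = map (\<lambda>k. int (bwd a j k)) [0..<n]"

definition fwords :: "(int \<Rightarrow> nat) \<Rightarrow> int \<Rightarrow> nat \<Rightarrow> int list" where
  "fwords a j n = map (\<lambda>k. int (fwd a j k)) [0..<n]"

lemma words_cong:
  assumes "\<And>d. - int n \<le> d \<Longrightarrow> d \<le> int n \<Longrightarrow> a (i + d) = b (j + d)"
  shows "bwords a i n = bwords b j n" "fwords a i n = fwords b j n"
proof -
  have "a (i - 1 - int k) = b (j - 1 - int k)" "a (i + 1 + int k) = b (j + 1 + int k)" if "k < n" for k
    using assms[of "- 1 - int k"] assms[of "1 + int k"] that by (auto simp: algebra_simps)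
  then show "bwords a i n = bwords b j n" "fwords a i n = fwords b j n"
    by (auto simp: bwords_def fwords_def bwd_def fwd_def)
qed

text \<open>Depends on seven digits to each side only, so it can be evaluated and transferred
  between equal windows.\<close>

definition moderate :: "(int \<Rightarrow> nat) \<Rightarrow> int \<Rightarrow> bool" where
  "moderate a j \<longleftrightarrow> a j \<le> 2 \<or> below 94 100 (cf_bounds (bwords a j 7)) (cf_bounds (fwords a j 7))"

context
  fixes a :: "int \<Rightarrow> nat"
  assumes bounds: "\<And>i. 1 \<le> a i" "\<And>i. a i \<le> 3"
begin

lemma above_words:
  "above N D (cf_bounds (bwords a j n)) (cf_bounds (fwords a j n)) \<Longrightarrow> 0 < D
    \<Longrightarrow> real (a j) + real_of_int N / real_of_int D \<le> lambda_at a j"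
  by (rule above) (auto simp: bwords_def fwords_def agrees_map intro: bounds simp del: One_nat_def)

lemma below_words:
  "below N D (cf_bounds (bwords a j n)) (cf_bounds (fwords a j n)) \<Longrightarrow> 0 < D
    \<Longrightarrow> lambda_at a j \<le> real (a j) + real_of_int N / real_of_int D"
  by (rule below) (auto simp: bwords_def fwords_def agrees_map intro: bounds simp del: One_nat_def)

lemma moderate:
  assumes "moderate a j"
  shows "lambda_at a j \<le> 3.94"
proof (cases "a j \<le> 2")
  case True
  have "cf0 (bwd a j) \<le> 4 / 5" "cf0 (fwd a j) \<le> 4 / 5"
    by (rule cf0_bounds; auto simp: bwd_def fwd_def intro: bounds simp del: One_nat_def)+
  with True have "lambda_at a j \<le> 2 + 4 / 5 + 4 / 5"
    using lambda_at_eq[where a = a and j = j, OF bounds(1)] by linarith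
  then show ?thesis
    by simp
next
  case False
  then have "a j = 3" "below 94 100 (cf_bounds (bwords a j 7)) (cf_bounds (fwords a j 7))"
    using assms bounds(2)[of j] by (auto simp: moderate_def)
  then show ?thesis
    using below_words[of 94 100 j 7] by simp
qed

end

lemma moderate_cong:
  assumes "\<And>d. - 7 \<le> d \<Longrightarrow> d \<le> 7 \<Longrightarrow> a (i + d) = b (j + d)"
  shows "moderate a i \<longleftrightarrow> moderate b j"
  using words_cong[of 7 a i b j] assms[of 0] assms by (simp add: moderate_def)

lemma moderate_j0_seq:
  assumes "j mod 17 \<noteq> 0"
  shows "moderate j0_seq j"
proof -
  have "list_all (moderate j0_seq) [1..16]"
    by code_simp
  moreover have "j mod 17 \<in> set [1..16]"
    unfolding set_upto atLeastAtMost_iff using assms by presburger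
  ultimately have "moderate j0_seq (j mod 17)"
    unfolding list_all_iff by blast
  then show ?thesis
    using moderate_cong[of j0_seq "j mod 17" j0_seq j] by (simp add: j0_seq_mod)
qed

lemma moderate_m1_seq:
  assumes "18 \<le> j"
  shows "moderate m1_seq j"
proof -
  have *: "list_all (moderate m1_seq) [18..41]"
    by code_simp
  show ?thesis
  proof (cases "j \<le> 41")
    case True
    with assms have "j \<in> set [18..41]"
      by (simp only: set_upto atLeastAtMost_iff)
    with * show ?thesis
      unfolding list_all_iff by blast
  next
    case False
    \<comment> \<open>From 42 on the window lies in the tail of period 2, and so do those of the
      representatives 40 and 41, as 40 - 7 = 33.\<close>
    have "(40 + j mod 2 + d - 33) mod 2 = (j + d - 33) mod 2" for d
      by presburger
    then have "m1_seq (40 + j mod 2 + d) = m1_seq (j + d)" if "- 7 \<le> d" for d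
      using False that by (simp add: m1_seq_tail)
    then have "moderate m1_seq (40 + j mod 2) \<longleftrightarrow> moderate m1_seq j"
      by (intro moderate_cong) auto
    moreover have "40 + j mod 2 \<in> set [18..41]"
      unfolding set_upto atLeastAtMost_iff by presburger
    ultimately show ?thesis
      using * unfolding list_all_iff by blast
  qed
qed

lemma j0_seq_0: "j0_seq 0 = 3" and m1_seq_0: "m1_seq 0 = 3" and m1_seq_17: "m1_seq 17 = 3"
  by code_simp+

abbreviation "j0_upper \<equiv> 3 + 94200115991134146921354803 / 10 ^ 26 :: real"

lemma lambda_at_j0_seq_0:
  "3 + 94200115991134146921354802 / 10 ^ 26 \<le> lambda_at j0_seq 0" "lambda_at j0_seq 0 \<le> j0_upper"
proof -
  have "above 94200115991134146921354802 (10 ^ 26) (cf_bounds (bwords j0_seq 0 50)) (cf_bounds (fwords j0_seq 0 50))"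
    by code_simp
  from above_words[of j0_seq, OF j0_seq_bounds this]
  show "3 + 94200115991134146921354802 / 10 ^ 26 \<le> lambda_at j0_seq 0"
    by (simp add: j0_seq_0)
  have "below 94200115991134146921354803 (10 ^ 26) (cf_bounds (bwords j0_seq 0 50)) (cf_bounds (fwords j0_seq 0 50))"
    by code_simp
  from below_words[of j0_seq, OF j0_seq_bounds this]
  show "lambda_at j0_seq 0 \<le> j0_upper"
    by (simp add: j0_seq_0)
qed

lemma lambda_at_j0_seq_le: "lambda_at j0_seq j \<le> lambda_at j0_seq 0"
proof (cases "j mod 17 = 0")
  case True
  then have "j0_seq (j + d) = j0_seq (0 + d)" for d
    using j0_seq_mod[of j d] by simp
  from this[of "- 1 - int k" for k] this[of "1 + int k" for k] this[of 0]
  have "bwd j0_seq j = bwd j0_seq 0" "fwd j0_seq j = fwd j0_seq 0" "j0_seq j = j0_seq 0"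
    by (auto simp: bwd_def fwd_def fun_eq_iff algebra_simps)
  then show ?thesis
    by (simp add: lambda_at_eq j0_seq_bounds del: One_nat_def)
next
  case False
  then have "lambda_at j0_seq j \<le> 3.94"
    by (intro moderate moderate_j0_seq j0_seq_bounds)
  then show ?thesis
    using lambda_at_j0_seq_0(1) by simp
qed

lemma markov_value_eq:
  assumes "\<And>j. lambda_at a j \<le> lambda_at a 0"
  shows "markov_value a = ereal (lambda_at a 0)"
  unfolding markov_value_def using assms by (intro antisym SUP_least SUP_upper) auto

lemma j0_eq: "j0 = lambda_at j0_seq 0"
  by (simp add: j0_def markov_value_eq lambda_at_j0_seq_le)

lemma m1_bounds:
  "3 + 942001159911341469214374651 / 10 ^ 27 \<le> m1" "m1 \<le> 3 + 942001159911341469214374652 / 10 ^ 27"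
proof -
  have "above 942001159911341469214374651 (10 ^ 27) (cf_bounds (bwords m1_seq 0 50)) (cf_bounds (fwords m1_seq 0 50))"
    by code_simp
  from above_words[of m1_seq, OF m1_seq_bounds this]
  show "3 + 942001159911341469214374651 / 10 ^ 27 \<le> m1"
    by (simp add: m1_seq_0 m1_def)
  have "below 942001159911341469214374652 (10 ^ 27) (cf_bounds (bwords m1_seq 0 50)) (cf_bounds (fwords m1_seq 0 50))"
    by code_simp
  from below_words[of m1_seq, OF m1_seq_bounds this]
  show "m1 \<le> 3 + 942001159911341469214374652 / 10 ^ 27"
    by (simp add: m1_seq_0 m1_def)
qed

text \<open>Away from the marked digits \<open>moderate\<close> applies. At 17 the changed right
  side pushes the value below 3.942001159. At the copies left of 0 the 40 digits on each side are
  those of the periodic sequence, whose value is smaller than m1 by more than 8 / 10^22.\<close>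

lemma lambda_at_m1_seq_le: "lambda_at m1_seq j \<le> lambda_at m1_seq 0"
proof -
  have "j = 17 \<or> j = 0 \<or> j \<le> - 17" if "j < 18" "j mod 17 = 0"
    using that by presburger
  then consider "18 \<le> j \<or> j < 18 \<and> j mod 17 \<noteq> 0" | "j = 17" | "j = 0" | "j \<le> - 17" "j mod 17 = 0"
    by fastforce
  then show ?thesis
  proof cases
    case 1
    then have "moderate m1_seq j"
    proof (elim disjE conjE)
      assume "j < 18" "j mod 17 \<noteq> 0"
      then show ?thesis
        using moderate_cong[of m1_seq j j0_seq j] moderate_j0_seq[of j] by (auto simp: m1_seq_eq_j0_seq)
    qed (rule moderate_m1_seq)
    then have "lambda_at m1_seq j \<le> 3.94"
      by (intro moderate m1_seq_bounds)
    then show ?thesis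
      using m1_bounds(1) by (simp add: m1_def)
  next
    case 2
    have "below 942001159 (10 ^ 9) (cf_bounds (bwords m1_seq 17 20)) (cf_bounds (fwords m1_seq 17 20))"
      by code_simp
    from below_words[of m1_seq, OF m1_seq_bounds this] show ?thesis
      using m1_bounds(1) 2 by (simp add: m1_seq_17 m1_def)
  next
    case 4
    \<comment> \<open>Here \<open>j + d\<close> is at most 25, where the two sequences still
      coincide.\<close>
    have eq: "m1_seq (j + d) = j0_seq (0 + d)" if "d \<le> 42" for d
      using 4 that j0_seq_mod[of j d] by (simp add: m1_seq_eq_j0_seq)
    have "below 94200115991134146921354803 (10 ^ 26) (cf_bounds (bwords j0_seq 0 40)) (cf_bounds (fwords j0_seq 0 40))"
      by code_simp
    then have "below 94200115991134146921354803 (10 ^ 26) (cf_bounds (bwords m1_seq j 40)) (cf_bounds (fwords m1_seq j 40))"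
      using words_cong[of 40 m1_seq j j0_seq 0] eq by simp
    from below_words[of m1_seq, OF m1_seq_bounds this] show ?thesis
      using m1_bounds(1) eq[of 0] by (simp add: j0_seq_0 m1_def)
  qed simp
qed

theorem theorem1p3:
  shows "(markov_spectrum - lagrange_spectrum) \<inter> {3.942<..<3.943} \<noteq> {}
    \<and> m1 \<in> markov_spectrum - lagrange_spectrum
    \<and> 3.94200115991134146921437465 \<le> m1 \<and> m1 < 3.94200115991134146921437466
    \<and> 8.26 / 10 ^ 22 \<le> m1 - j0 \<and> m1 - j0 < 8.27 / 10 ^ 22"
proof -
  have "markov_value m1_seq = ereal m1"
    unfolding m1_def by (rule markov_value_eq) (rule lambda_at_m1_seq_le)
  then have "m1 \<in> markov_spectrum"
    using m1_seq_bounds(1) unfolding markov_spectrum_def by blast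
  moreover have "m1 \<notin> lagrange_spectrum"
    using m1_bounds by (intro not_in_lagrange_spectrum) (auto simp: lower_def upper_def)
  moreover have "m1 \<in> {3.942<..<3.943}"
    using m1_bounds by simp
  moreover have "3.94200115991134146921437465 \<le> m1 \<and> m1 < 3.94200115991134146921437466"
    using m1_bounds by simp
  moreover have "8.26 / 10 ^ 22 \<le> m1 - j0 \<and> m1 - j0 < 8.27 / 10 ^ 22"
    using m1_bounds lambda_at_j0_seq_0 unfolding j0_eq by simp
  ultimately show ?thesis
    by blast
qed

end
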